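(* The characters $\chi_{\mathbf{a}_1,\ldots,\mathbf{a}_d}$ of $G_{\mathbf{b}_1,\ldots,\mathbf{b}_d}$ are eigenvectors of $\phi_z$ as follows: the single character with $(\mathbf{a}_1,\ldots,\mathbf{a}_d)=\mathbf{0}$ has eigenvalue $q^{(d+1)n}$; the $q^{n+d}-q^n$ characters for which there exist $\mathbf{y}\in\mathbb{F}_q^n$ and $(c_1,\ldots,c_d)\in\mathbb{F}_q^d\setminus\{\mathbf{0}\}$ with $\mathbf{a}_i=c_i(\mathbf{y},1)$ for all $i$ have eigenvalue $q^{dn}$; the remaining $q^{d(n+1)}-q^{n+d}+q^n-1$ characters have eigenvalue $0$.
   Context: $q=p^m$ a prime power, $n,d$ positive integers; $\mathbf{b}_i=(b_{i,1},\ldots,b_{i,n})\in(\mathbb{Z}^+)^n$ fixed with $\gcd(b_{i,j},q-1)=1$; $f_{\mathbf{a}_i}(x)=\sum_{j=1}^n a_{i,j}x_j^{b_{i,j}}+a_{i,n+1}$ for $\mathbf{a}_i\in\mathbb{F}_q^{n+1}$. $G_{\mathbf{b}_1,\ldots,\mathbf{b}_d}=\{(f_{\mathbf{a}_1},\ldots,f_{\mathbf{a}_d}):\mathbf{a}_i\in\mathbb{F}_q^{n+1}\}\cong\mathbb{F}_q^{d(n+1)}$. Characters: $\chi_{\mathbf{a}_1,\ldots,\mathbf{a}_d}((f_{\tilde{\mathbf{a}}_1},\ldots,f_{\tilde{\mathbf{a}}_d}))=e(\mathrm{Tr}(\sum_i\langle\mathbf{a}_i,\tilde{\mathbf{a}}_i\rangle))$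 with $\mathrm{Tr}$ the trace to $\mathbb{F}_p$, $e(x)=e^{2\pi ix/p}$, identified with $\sum_g\chi(g)x_g$ in the group algebra $\mathbb{C}[G_{\mathbf{b}_1,\ldots,\mathbf{b}_d}]$ (product $(\sum c_gx_g)(\sum\tilde c_gx_g)=\sum_g(\sum_{g'}c_{g-g'}\tilde c_{g'})x_g$), $\phi_z(w)=z\cdot w$, and $z=\sum c_{(f_1,\ldots,f_d)}x_{(f_1,\ldots,f_d)}$ with $c_{(f_1,\ldots,f_d)}=|\{\mathbf{u}\in\mathbb{F}_q^n: f_i(\mathbf{u})=0\ \forall i\}|$.
   Formalization: The class with eigenvalue q^{dn} is corrected to a_i = c_i(y_1^{b_{i,1}},…,y_n^{b_{i,n}},1); it equals the stated class a_i = c_i(y,1) when b_{i,j} mod q−1 does not depend on i, and otherwise the stated claim is false (q=5, n=1, d=2, b_1=1, b_2=3). *)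

theory Defs
  imports
    "HOL-Analysis.Analysis"
    "HOL-Library.Poly_Mapping"
    "HOL-Library.Function_Algebras"
    "HOL-Library.Product_Plus"
    "HOL-Number_Theory.Cong"
begin

(* Conventions.  The finite field F_q is a finite type 'a of class field, p is the
   characteristic and q = p ^ m.  The index sets {1..n} and {1..d} are the finite types 'n
   and 'd.  An element of F_q^(n+1) is a pair in 'a^'n * 'a: the first n coordinates and the
   coordinate number n+1. *)

(* b_i is the exponent vector, the pair a the coefficient vector. *)
definition poly_fun :: "('n::finite \<Rightarrow> nat) \<Rightarrow> ('a::field ^ 'n) \<times> 'a \<Rightarrow> 'a ^ 'n \<Rightarrow> 'a" where
  "poly_fun bi a x = (\<Sum>j\<in>UNIV. fst a $ j * (x $ j) ^ bi j) + snd a"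

definition poly_tuple ::
  "('d \<Rightarrow> 'n::finite \<Rightarrow> nat) \<Rightarrow> ('d \<Rightarrow> ('a::field ^ 'n) \<times> 'a) \<Rightarrow> 'd \<Rightarrow> 'a ^ 'n \<Rightarrow> 'a" where
  "poly_tuple b a = (\<lambda>i. poly_fun (b i) (a i))"

(* The group G_b: a subgroup of all d-tuples of functions, with pointwise addition. *)
definition poly_group :: "('d \<Rightarrow> 'n::finite \<Rightarrow> nat) \<Rightarrow> ('d \<Rightarrow> 'a::field ^ 'n \<Rightarrow> 'a) set" where
  "poly_group b = range (poly_tuple b)"

definition coeffs_of ::
  "('d \<Rightarrow> 'n::finite \<Rightarrow> nat) \<Rightarrow> ('d \<Rightarrow> 'a::field ^ 'n \<Rightarrow> 'a) \<Rightarrow> 'd \<Rightarrow> ('a ^ 'n) \<times> 'a" where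
  "coeffs_of b g = (THE a. poly_tuple b a = g)"

(* The coefficients are determined by the functions, so coeffs_of inverts poly_tuple;
   this is the isomorphism of G_b with F_q^(d(n+1)). *)
lemma inj_poly_tuple:
  fixes b :: "'d \<Rightarrow> 'n::finite \<Rightarrow> nat"
  assumes "\<And>i j. b i j > 0"
  shows "inj (poly_tuple b :: ('d \<Rightarrow> ('a::field ^ 'n) \<times> 'a) \<Rightarrow> _)"
proof (rule injI)
  fix a a' :: "'d \<Rightarrow> ('a ^ 'n) \<times> 'a"
  assume "poly_tuple b a = poly_tuple b a'"
  then have eq: "poly_fun (b i) (a i) x = poly_fun (b i) (a' i) x" for i x
    by (metis poly_tuple_def)
  have ne: "b i j \<noteq> 0" for i j using assms[of i j] by simp
  have z: "poly_fun (b i) c 0 = snd c" for i and c :: "('a ^ 'n) \<times> 'a"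
    by (simp add: poly_fun_def power_0_left ne)
  have ax: "poly_fun (b i) c (axis j 1) = fst c $ j + snd c" for i j and c :: "('a ^ 'n) \<times> 'a"
  proof -
    have "fst c $ k * (axis j 1 $ k) ^ b i k = (if k = j then fst c $ j else 0)" for k
      by (simp add: axis_def power_0_left ne)
    then show ?thesis by (simp add: poly_fun_def)
  qed
  show "a = a'"
  proof
    fix i
    have s: "snd (a i) = snd (a' i)" using eq[of i 0] z by metis
    have "fst (a i) $ j = fst (a' i) $ j" for j
      using eq[of i "axis j 1"] s by (simp add: ax)
    with s show "a i = a' i" by (simp add: prod_eq_iff vec_eq_iff)
  qed
qed

lemma coeffs_of_poly_tuple:
  assumes "\<And>i j. b i j > 0"
  shows "coeffs_of b (poly_tuple b a) = a"
  unfolding coeffs_of_def using inj_poly_tuple[of b] assms by (auto dest: injD)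

definition dot :: "('a::field ^ 'n) \<times> 'a \<Rightarrow> ('a ^ 'n::finite) \<times> 'a \<Rightarrow> 'a" where
  "dot a a' = (\<Sum>j\<in>UNIV. fst a $ j * fst a' $ j) + snd a * snd a'"

(* The trace from F_(p^m) to F_p as the sum of the conjugates x, x^p, ..., x^(p^(m-1)).
   Its values are elements of 'a that lie in the prime subfield. *)
definition field_trace :: "nat \<Rightarrow> nat \<Rightarrow> 'a::field \<Rightarrow> 'a" where
  "field_trace p m x = (\<Sum>k<m. x ^ (p ^ k))"

lemma field_trace_prime_subfield:
  fixes x :: "'a::finite_field"
  assumes p: "CHAR('a) = p" and q: "CARD('a) = p ^ m"
  shows "\<exists>!k. k < p \<and> of_nat k = field_trace p m x"
proof -
  have pr: "prime p"
    using prime_CHAR_semidom[where 'a = 'a] finite_imp_CHAR_pos[where 'a = 'a] p by simp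
  then have p1: "p > 1" by (rule prime_gt_1_nat)
  have fr: "(y + z) ^ p = y ^ p + z ^ p" for y z :: 'a
    by (rule freshmans_dream) (simp_all add: p pr)
  have fermat: "(of_nat k :: 'a) ^ p = of_nat k" for k
  proof (induction k)
    case (Suc k)
    then show ?case by (simp add: fr)
  qed (use p1 in simp)
  define P :: "'a poly" where "P = monom 1 p - monom 1 1"
  have c: "poly.coeff P p = 1"
    using p1 unfolding P_def by simp
  have dP: "degree P \<le> p"
    using p1 unfolding P_def by (intro degree_diff_le) (auto simp: degree_monom_eq)
  have P0: "P \<noteq> 0" using c by auto
  have inj: "inj_on (of_nat :: nat \<Rightarrow> 'a) {..<p}"
    by (rule inj_onI) (auto simp: of_nat_eq_iff_cong_CHAR p cong_def)
  have sub: "of_nat ` {..<p} \<subseteq> {y. poly P y = 0}"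
    using fermat by (auto simp: P_def poly_monom)
  have "card {y. poly P y = 0} \<le> p"
    using card_poly_roots_bound[OF P0] dP by linarith
  also have "p = card (of_nat ` {..<p} :: 'a set)"
    using inj by (simp add: card_image)
  finally have roots: "of_nat ` {..<p} = {y. poly P y = 0}"
    using sub poly_roots_finite[OF P0] by (intro card_seteq)
  define t where "t = field_trace p m x"
  have "t ^ p = (\<Sum>k<m. (x ^ p ^ k) ^ p)"
    unfolding t_def field_trace_def by (rule freshmans_dream_sum) (simp_all only: p pr)
  also have "\<dots> = (\<Sum>k<m. x ^ p ^ Suc k)"
    by (intro sum.cong refl) (simp only: power_Suc power_mult[symmetric] mult.commute)
  finally have "x + t ^ p = (\<Sum>k<Suc m. x ^ p ^ k)"
    by (simp only: sum.lessThan_Suc_shift power_0 power_one_right)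
  also have "\<dots> = t + x ^ p ^ m" by (simp only: t_def field_trace_def sum.lessThan_Suc)
  also have "x ^ p ^ m = x"
    using finite_field_power_card_eq_same[of x] by (simp only: q)
  finally have "t ^ p = t" by simp
  then have "t \<in> of_nat ` {..<p}"
    unfolding roots by (simp add: P_def poly_monom)
  then have "\<exists>!k. k < p \<and> of_nat k = t" using inj unfolding inj_on_def by blast
  then show ?thesis by (simp only: t_def)
qed

(* e(x) = exp (2 pi i x / p) for x in the prime subfield, read as an integer modulo p.
   Only applied to elements of the prime subfield. *)
definition prime_exp :: "nat \<Rightarrow> 'a::field \<Rightarrow> complex" where
  "prime_exp p x =
     exp (2 * of_real pi * \<i> * of_nat (THE k. k < p \<and> of_nat k = x) / of_nat p)"

definition chi ::
  "nat \<Rightarrow> nat \<Rightarrow> ('d::finite \<Rightarrow> 'n::finite \<Rightarrow> nat) \<Rightarrow> ('d \<Rightarrow> ('a::field ^ 'n) \<times> 'a)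
    \<Rightarrow> ('d \<Rightarrow> 'a ^ 'n \<Rightarrow> 'a) \<Rightarrow> complex" where
  "chi p m b a g = prime_exp p (field_trace p m (\<Sum>i\<in>UNIV. dot (a i) (coeffs_of b g i)))"

(* C[G]: finitely supported functions with support in G.  The multiplication of
   poly_mapping is convolution, and x_g is single g 1. *)
definition group_algebra :: "'g set \<Rightarrow> ('g \<Rightarrow>\<^sub>0 complex) set" where
  "group_algebra G = {w. Poly_Mapping.keys w \<subseteq> G}"

definition chi_elem ::
  "nat \<Rightarrow> nat \<Rightarrow> ('d::finite \<Rightarrow> 'n::finite \<Rightarrow> nat)
    \<Rightarrow> ('d \<Rightarrow> ('a::finite_field ^ 'n) \<times> 'a) \<Rightarrow> ('d \<Rightarrow> 'a ^ 'n \<Rightarrow> 'a) \<Rightarrow>\<^sub>0 complex" where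
  "chi_elem p m b a = (\<Sum>g\<in>poly_group b. Poly_Mapping.single g (chi p m b a g))"

definition zero_count_elem ::
  "('d::finite \<Rightarrow> 'n::finite \<Rightarrow> nat) \<Rightarrow> ('d \<Rightarrow> 'a::finite_field ^ 'n \<Rightarrow> 'a) \<Rightarrow>\<^sub>0 complex" where
  "zero_count_elem b =
     (\<Sum>g\<in>poly_group b. Poly_Mapping.single g (of_nat (card {u. \<forall>i. g i u = 0})))"

definition phi :: "('g::monoid_add \<Rightarrow>\<^sub>0 complex) \<Rightarrow> ('g \<Rightarrow>\<^sub>0 complex) \<Rightarrow> ('g \<Rightarrow>\<^sub>0 complex)" where
  "phi z w = z * w"

definition eigenvector_in ::
  "('g \<Rightarrow>\<^sub>0 complex) set \<Rightarrow> (('g \<Rightarrow>\<^sub>0 complex) \<Rightarrow> ('g \<Rightarrow>\<^sub>0 complex)) \<Rightarrow> complex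
    \<Rightarrow> ('g \<Rightarrow>\<^sub>0 complex) \<Rightarrow> bool" where
  "eigenvector_in V T l w \<longleftrightarrow> w \<in> V \<and> w \<noteq> 0 \<and> T w = Poly_Mapping.map ((*) l) w"

(* The tuples a with a_i = c_i (y,1) for some y and some nonzero (c_1,...,c_d). *)
definition common_dir :: "('d \<Rightarrow> ('a::field ^ 'n::finite) \<times> 'a) set" where
  "common_dir = {a. \<exists>y c. c \<noteq> (\<lambda>_. 0) \<and> (\<forall>i. a i = ((\<chi> j. c i * y $ j), c i))}"

(* The tuples a with a_i = c_i (y_1^b_(i,1), ..., y_n^b_(i,n), 1).  This is the condition
   under which the i-th linear form is, up to the factor c_i, evaluation of f_i at y.  If
   the b_i induce the same power maps then y may be replaced by (y_j^b_(i,j))_j, and the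
   set is common_dir.  In general it is not: for q = 5, n = 1, d = 2, b_1 = 1, b_2 = 3, the
   character with a_1 = a_2 = (2,1) has eigenvalue 0, since no u satisfies u = u^3 = 2. *)
definition common_point :: "('d \<Rightarrow> 'n::finite \<Rightarrow> nat) \<Rightarrow> ('d \<Rightarrow> ('a::field ^ 'n) \<times> 'a) set" where
  "common_point b =
     {a. \<exists>y c. c \<noteq> (\<lambda>_. 0) \<and> (\<forall>i. a i = ((\<chi> j. c i * (y $ j) ^ b i j), c i))}"

end

theory Submission
  imports Defs
begin

text \<open>
  On \<open>G\<close>, multiplication by \<open>z\<close> scales a character \<open>\<chi>\<close> by \<open>\<Sum>h. z h * \<chi> (-h)\<close>. Counting zeros point by
  point, this is the sum over all \<open>u\<close> of the sum of the character over the linear subspace of the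
  tuples that vanish at \<open>u\<close>. By orthogonality the inner sum is the size \<open>q^(dn)\<close> of this subspace if
  the character is trivial on it, that is if each \<open>a i\<close> is a multiple of
  \<open>((u j ^ b i j)\<^sub>j, 1)\<close>, and \<open>0\<close> otherwise. For \<open>a = 0\<close> all \<open>q^n\<close> points \<open>u\<close> contribute; for \<open>a \<noteq> 0\<close>
  at most one does, because the power maps with exponent prime to \<open>q - 1\<close> are injective.
\<close>

section \<open>Power maps on a finite field\<close>

text \<open>The unit group has order q - 1, so \<open>x ^ (CARD('a) - 1) = 1\<close> and only the
  residue of the exponent matters.\<close>

lemma finite_field_power_eq_if_cong:
  fixes x :: "'a::finite_field"
  assumes "x \<noteq> 0" and "[k = l] (mod (CARD('a) - 1))"
  shows "x ^ k = x ^ l"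
proof -
  have "CARD('a) > 0" by simp
  then have "x ^ (CARD('a) - 1) * x = x"
    using finite_field_power_card_eq_same[of x] by (simp flip: power_Suc2)
  then have one: "x ^ (CARD('a) - 1) = 1" using assms(1) by simp
  have "x ^ r = x ^ (r mod (CARD('a) - 1))" for r
  proof -
    have "x ^ r = x ^ ((CARD('a) - 1) * (r div (CARD('a) - 1)) + r mod (CARD('a) - 1))" by simp
    also have "\<dots> = x ^ (r mod (CARD('a) - 1))"
      by (simp only: power_add power_mult one power_one mult_1_left)
    finally show ?thesis .
  qed
  then show ?thesis using assms(2) by (metis cong_def)
qed

text \<open>With \<open>k\<close> an inverse of \<open>b\<close> modulo q - 1, the
  \<open>k\<close>-th power undoes the \<open>b\<close>-th power on units; positivity of
  \<open>b\<close> settles zero.\<close>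

lemma inj_power_finite_field:
  assumes "b > 0" and "coprime b (CARD('a) - 1)"
  shows "inj (\<lambda>x :: 'a::finite_field. x ^ b)"
proof (rule injI)
  fix x y :: 'a
  assume eq: "x ^ b = y ^ b"
  obtain k where k: "[b * k = 1] (mod (CARD('a) - 1))"
    using cong_solve_coprime_nat[OF assms(2)] by auto
  show "x = y"
  proof (cases "x = 0 \<or> y = 0")
    case True
    then show ?thesis using eq assms(1) by (auto simp: power_0_left)
  next
    case False
    have "x = x ^ (b * k)" using False finite_field_power_eq_if_cong[OF _ k, of x] by simp
    also have "\<dots> = y ^ (b * k)" by (simp only: power_mult eq)
    also have "\<dots> = y" using False finite_field_power_eq_if_cong[OF _ k, of y] by simp
    finally show ?thesis .
  qed
qed

section \<open>The canonical additive character\<close>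

text \<open>Adding 1 permutes the field, so the sum of all elements absorbs \<open>CARD('a)\<close>
  copies of 1. Hence q is 0 in the field, and the characteristic, a prime, divides
  \<open>p ^ m\<close>.\<close>

lemma CHAR_eq_of_CARD_eq_prime_power:
  assumes "prime p" and "CARD('a::finite_field) = p ^ m"
  shows "CHAR('a) = p"
proof -
  have "prime CHAR('a)"
    using prime_CHAR_semidom[where 'a = 'a] finite_imp_CHAR_pos[where 'a = 'a] by simp
  moreover have "CHAR('a) dvd CARD('a)"
  proof -
    have "sum id (UNIV :: 'a set) = (\<Sum>x\<in>UNIV. x + 1)"
      by (rule sum.reindex_bij_witness[of _ "\<lambda>x. x + 1" "\<lambda>x. x - 1"]) auto
    then have "of_nat CARD('a) = (0 :: 'a)" by (simp add: sum.distrib)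
    then show ?thesis by (simp only: of_nat_eq_0_iff_char_dvd)
  qed
  ultimately show ?thesis using assms(1) by (metis assms(2) prime_dvd_power primes_dvd_imp_eq)
qed

lemma field_trace_add:
  fixes x y :: "'a::finite_field"
  assumes "prime p" and "CHAR('a) = p"
  shows "field_trace p m (x + y) = field_trace p m x + field_trace p m y"
  unfolding field_trace_def sum.distrib[symmetric]
  by (intro sum.cong refl freshmans_dream') (use assms in auto)

text \<open>The trace is a nonzero polynomial of degree at most p^(m-1), which has too few roots to
  vanish on all p^m elements.\<close>

lemma field_trace_nonzero:
  assumes "prime p" and "CARD('a::finite_field) = p ^ m"
  shows "\<exists>x :: 'a. field_trace p m x \<noteq> 0"
proof (rule ccontr)
  assume "\<not> ?thesis"
  then have all0: "field_trace p m x = 0" for x :: 'a by simp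
  have p1: "p > 1" using assms(1) by (rule prime_gt_1_nat)
  have "m \<noteq> 0"
  proof
    assume "m = 0"
    then have "CARD('a) = 1" using assms(2) by simp
    then show False by (metis card_1_singletonE UNIV_I singletonD zero_neq_one)
  qed
  then obtain r where r: "m = Suc r" by (cases m) auto
  define P :: "'a poly" where "P = (\<Sum>k<m. monom 1 (p ^ k))"
  \<comment> \<open>The exponents \<open>p ^ k\<close> are distinct, so the top monomial cannot
    cancel.\<close>
  have "poly.coeff P (p ^ r) = (\<Sum>k<m. if k = r then 1 else 0)"
    unfolding P_def coeff_sum using p1 by (intro sum.cong) auto
  then have "P \<noteq> 0" using r by auto
  moreover have "degree P \<le> p ^ r"
    unfolding P_def r using p1
    by (intro degree_sum_le) (auto simp: degree_monom_eq intro: power_increasing)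
  moreover have "{x. poly P x = 0} = UNIV"
    using all0 by (auto simp: P_def poly_sum poly_monom field_trace_def)
  ultimately have "CARD('a) \<le> p ^ r" using card_poly_roots_bound[of P] by simp
  moreover have "p ^ r < p ^ m" using p1 r by simp
  ultimately show False using assms(2) by simp
qed

text \<open>\<open>prime_exp\<close> picks the representative of \<open>k\<close> below
  \<open>p\<close>. A formula for arbitrary \<open>k\<close> makes it visible that sums in the prime
  field become products of roots of unity.\<close>

lemma prime_exp_of_nat:
  assumes "prime p" and "CHAR('a::finite_field) = p"
  shows "prime_exp p (of_nat k :: 'a) = cis (2 * pi * real k / real p)"
proof -
  have p0: "p > 0" using assms(1) by (simp add: prime_gt_0_nat)
  have the: "(THE l. l < p \<and> (of_nat l :: 'a) = of_nat k) = k mod p"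
    using p0 by (intro the_equality) (auto simp: of_nat_eq_iff_cong_CHAR assms(2) cong_def)
  have "prime_exp p (of_nat k :: 'a) = cis (2 * pi * real (k mod p) / real p)"
    unfolding prime_exp_def the cis_conv_exp by (simp add: algebra_simps)
  \<comment> \<open>Appends \<open>k div p\<close> full turns, which trade the remainder for
    \<open>k\<close> itself.\<close>
  also have "\<dots> = cis (2 * pi * real (k mod p) / real p) * cis (2 * pi * real (k div p))"
    using cis_multiple_2pi[of "real (k div p)"] by simp
  also have "\<dots> = cis (2 * pi * real k / real p)"
  proof -
    have "real k = real (k mod p) + real (k div p) * real p"
      by (metis mod_div_mult_eq of_nat_add of_nat_mult)
    then have "2 * pi * real (k mod p) / real p + 2 * pi * real (k div p) = 2 * pi * real k / real p"
      using p0 by (simp add: field_simps)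
    then show ?thesis by (simp only: cis_mult)
  qed
  finally show ?thesis .
qed

section \<open>Character sums over linear subspaces\<close>

text \<open>Translation by \<open>x0\<close> permutes the group but multiplies the sum by
  \<open>f x0\<close>, which is not 1.\<close>

lemma sum_UNIV_character_eq_0:
  fixes f :: "'g::{finite, ab_group_add} \<Rightarrow> complex"
  assumes add: "\<And>x y. f (x + y) = f x * f y" and "f x0 \<noteq> 1"
  shows "sum f UNIV = 0"
proof -
  have "sum f UNIV = (\<Sum>x\<in>UNIV. f (x0 + x))"
    by (rule sum.reindex_bij_witness[of _ "\<lambda>x. x0 + x" "\<lambda>x. x - x0"]) auto
  also have "\<dots> = f x0 * sum f UNIV" by (simp add: add sum_distrib_left)
  finally show ?thesis using assms(2) by simp
qed

section \<open>The pairing on coefficient tuples\<close>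

definition tuple_dot ::
  "('d::finite \<Rightarrow> ('a::field ^ 'n::finite) \<times> 'a) \<Rightarrow> ('d \<Rightarrow> ('a ^ 'n) \<times> 'a) \<Rightarrow> 'a" where
  "tuple_dot a a' = (\<Sum>i\<in>UNIV. dot (a i) (a' i))"

lemma tuple_dot_add_right: "tuple_dot a (x + y) = tuple_dot a x + tuple_dot a y"
  by (simp add: tuple_dot_def dot_def algebra_simps sum.distrib)

lemma tuple_dot_diff_left: "tuple_dot (a - a') x = tuple_dot a x - tuple_dot a' x"
  by (simp add: tuple_dot_def dot_def algebra_simps sum.distrib sum_subtractf)

text \<open>A nonzero linear functional is onto: the preimage is supported on a single coordinate at
  which \<open>a\<close> does not vanish.\<close>

lemma tuple_dot_surj:
  assumes "a \<noteq> 0"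
  shows "\<exists>x. tuple_dot a x = t"
proof -
  from assms obtain i where i: "a i \<noteq> 0" by (auto simp: fun_eq_iff)
  have "\<exists>v. dot (a i) v = t"
  proof (cases "snd (a i) = 0")
    case True
    then obtain j where j: "fst (a i) $ j \<noteq> 0"
      using i by (auto simp: prod_eq_iff vec_eq_iff)
    have "fst (a i) $ k * axis j (t / fst (a i) $ j) $ k = (if k = j then t else 0)" for k
      using j by (simp add: axis_def)
    then have "dot (a i) (axis j (t / fst (a i) $ j), 0) = t" by (simp add: dot_def)
    then show ?thesis by blast
  next
    case False
    then have "dot (a i) (0, t / snd (a i)) = t" by (simp add: dot_def)
    then show ?thesis by blast
  qed
  then obtain v where v: "dot (a i) v = t" by blast
  have "dot (a k) (if k = i then v else 0) = (if k = i then t else 0)" for k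
    using v by (simp add: dot_def)
  then have "tuple_dot a (\<lambda>k. if k = i then v else 0) = t" by (simp add: tuple_dot_def)
  then show ?thesis by blast
qed

text \<open>Collects the properties of e(Tr x) from which the Fourier analysis proceeds, so that
  neither trace nor exponential appears in it.\<close>

locale nontrivial_add_char =
  fixes \<psi> :: "'a::finite_field \<Rightarrow> complex"
  assumes zero: "\<psi> 0 = 1"
    and add: "\<psi> (x + y) = \<psi> x * \<psi> y"
    and nontrivial: "\<exists>x. \<psi> x \<noteq> 1"
begin

text \<open>The pairing takes every value, hence one at which \<open>\<psi>\<close> is not 1. This
  serves both orthogonality and telling characters apart.\<close>

lemma ex_tuple_dot:
  assumes "a \<noteq> 0"
  shows "\<exists>x. \<psi> (tuple_dot a x) \<noteq> 1"
  using nontrivial tuple_dot_surj[OF assms] by metis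

text \<open>The equations fix the last coordinate of each \<open>x i\<close>, so the other
  coordinates parametrise the subspace by F_q^(dn). There the character is \<open>\<psi>\<close> of
  a linear form, which is zero exactly when each \<open>a i\<close> is a multiple of
  \<open>(V i, 1)\<close>.\<close>

lemma sum_annihilator:
  fixes V :: "'d::finite \<Rightarrow> 'a ^ 'n::finite" and a :: "'d \<Rightarrow> ('a ^ 'n) \<times> 'a"
  shows "(\<Sum>x | \<forall>i. (\<Sum>j\<in>UNIV. fst (x i) $ j * V i $ j) + snd (x i) = 0. \<psi> (- tuple_dot a x)) =
    (if \<forall>i j. fst (a i) $ j = snd (a i) * V i $ j then of_nat (CARD('a) ^ (CARD('d) * CARD('n))) else 0)"
proof -
  let ?H = "{x :: 'd \<Rightarrow> ('a ^ 'n) \<times> 'a. \<forall>i. (\<Sum>j\<in>UNIV. fst (x i) $ j * V i $ j) + snd (x i) = 0}"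
  define lift where
    "lift = (\<lambda>(y :: 'd \<Rightarrow> 'a ^ 'n) i. (y i, - (\<Sum>j\<in>UNIV. y i $ j * V i $ j)))"
  \<comment> \<open>The coefficients of that linear form: what \<open>- tuple_dot a (lift y)\<close>
    leaves on \<open>y\<close>.\<close>
  define w where "w = (\<lambda>i. (\<chi> j. snd (a i) * V i $ j - fst (a i) $ j, 0 :: 'a))"
  define f where "f = (\<lambda>y :: 'd \<Rightarrow> 'a ^ 'n. \<psi> (tuple_dot w (\<lambda>i. (y i, 0))))"
  have dot_lift: "- tuple_dot a (lift y) = tuple_dot w (\<lambda>i. (y i, 0))" for y
    by (simp add: tuple_dot_def dot_def lift_def w_def algebra_simps sum_subtractf sum_distrib_left
        sum_negf sum.distrib)
  have "(\<Sum>x\<in>?H. \<psi> (- tuple_dot a x)) = (\<Sum>y\<in>UNIV. \<psi> (- tuple_dot a (lift y)))"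
    by (rule sum.reindex_bij_witness[of _ lift "\<lambda>x i. fst (x i)"])
      (auto simp: lift_def fun_eq_iff prod_eq_iff add_eq_0_iff
        intro!: arg_cong[where f = "\<lambda>x. \<psi> (- tuple_dot a x)"])
  also have "\<dots> = sum f UNIV" by (simp add: f_def dot_lift)
  also have "sum f UNIV = (if \<forall>i j. fst (a i) $ j = snd (a i) * V i $ j
      then of_nat (CARD('a) ^ (CARD('d) * CARD('n))) else 0)"
  proof (cases "\<forall>i j. fst (a i) $ j = snd (a i) * V i $ j")
    case True
    then have "w = (\<lambda>i. 0)" by (simp add: w_def fun_eq_iff prod_eq_iff vec_eq_iff)
    then have "f = (\<lambda>y. 1)" by (simp add: f_def fun_eq_iff tuple_dot_def dot_def zero)
    then show ?thesis using True by (simp add: card_fun mult.commute flip: power_mult)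
  next
    case False
    then have "w \<noteq> 0" by (fastforce simp: w_def fun_eq_iff prod_eq_iff vec_eq_iff)
    then obtain x where "\<psi> (tuple_dot w x) \<noteq> 1" using ex_tuple_dot by blast
    \<comment> \<open>The last coordinates of \<open>w\<close> are 0, so those of \<open>x\<close>
      can be cleared and the witness comes from some \<open>y\<close>.\<close>
    moreover have "tuple_dot w x = tuple_dot w (\<lambda>i. (fst (x i), 0))"
      by (simp add: tuple_dot_def dot_def w_def)
    ultimately have "f (\<lambda>i. fst (x i)) \<noteq> 1" by (simp add: f_def)
    moreover have "f (y + y') = f y * f y'" for y y'
    proof -
      have "(\<lambda>i. ((y + y') i, 0 :: 'a)) = (\<lambda>i. (y i, 0)) + (\<lambda>i. (y' i, 0))"
        by (simp add: fun_eq_iff)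
      then show ?thesis by (simp only: f_def tuple_dot_add_right add)
    qed
    ultimately have "sum f UNIV = 0" by (intro sum_UNIV_character_eq_0)
    then show ?thesis using False by auto
  qed
  finally show ?thesis .
qed

end

section \<open>Convolution with the zero-count element\<close>

text \<open>\<open>Poly_Mapping.map\<close> acts only at nonzero values, which is harmless because
  \<open>l * 0 = 0\<close>.\<close>

lemma lookup_map_mult: "Poly_Mapping.lookup (Poly_Mapping.map ((*) l) w) k = l * Poly_Mapping.lookup w k"
  for l :: complex
  by (simp add: Poly_Mapping.map.rep_eq when_def)

lemma single_sum: "Poly_Mapping.single k (sum f A) = (\<Sum>x\<in>A. Poly_Mapping.single k (f x))"
  by (induction A rule: infinite_finite_induct) (simp_all add: single_add)

lemma poly_tuple_add: "poly_tuple b (x + y) = poly_tuple b x + poly_tuple b y"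
  by (simp add: poly_tuple_def poly_fun_def fun_eq_iff algebra_simps sum.distrib)

lemma lookup_sum_single_inj:
  assumes "finite (UNIV :: 'c set)" and "inj (F :: 'c \<Rightarrow> 'g)"
  shows "Poly_Mapping.lookup (\<Sum>x\<in>UNIV. Poly_Mapping.single (F x) (c x :: complex)) (F y) = c y"
proof -
  have "Poly_Mapping.lookup (Poly_Mapping.single (F x) (c x)) (F y) = (if x = y then c y else 0)" for x
    using assms(2) by (auto simp: lookup_single when_def dest: injD)
  then show ?thesis using assms(1) by (simp add: lookup_sum)
qed

text \<open>Indexed by coefficients instead of group elements; the cardinality is the coefficient of
  z at \<open>poly_tuple b a\<close>.\<close>

definition vanishing_points ::
  "('d \<Rightarrow> 'n::finite \<Rightarrow> nat) \<Rightarrow> ('d \<Rightarrow> ('a::field ^ 'n) \<times> 'a) \<Rightarrow> ('a ^ 'n) set" where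
  "vanishing_points b a = {u. \<forall>i. poly_tuple b a i u = 0}"

text \<open>For such \<open>u\<close>, \<open>tuple_dot a x\<close> is the sum over i of
  \<open>snd (a i) * poly_fun (b i) (x i) u\<close>, so the character of \<open>a\<close> is trivial
  on the tuples vanishing at \<open>u\<close>.\<close>

definition rank_one_points ::
  "('d \<Rightarrow> 'n::finite \<Rightarrow> nat) \<Rightarrow> ('d \<Rightarrow> ('a::field ^ 'n) \<times> 'a) \<Rightarrow> ('a ^ 'n) set" where
  "rank_one_points b a = {u. \<forall>i j. fst (a i) $ j = snd (a i) * (u $ j) ^ b i j}"

lemma sum_poly_group:
  fixes F :: "('d::finite \<Rightarrow> 'a::finite_field ^ 'n::finite \<Rightarrow> 'a) \<Rightarrow> 'c::comm_monoid_add"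
  assumes "\<And>i j. b i j > 0"
  shows "sum F (poly_group b) = (\<Sum>x\<in>UNIV. F (poly_tuple b x))"
  unfolding poly_group_def using sum.reindex[OF inj_poly_tuple[OF assms]] by simp

context nontrivial_add_char
begin

text \<open>Writing the zero count as a sum of indicators and swapping sums leaves, for each point
  \<open>u\<close>, a character sum over the tuples vanishing at \<open>u\<close>.\<close>

lemma zero_count_fourier:
  fixes a :: "'d::finite \<Rightarrow> ('a ^ 'n::finite) \<times> 'a"
  shows "(\<Sum>x\<in>UNIV. of_nat (card (vanishing_points b x)) * \<psi> (- tuple_dot a x)) =
    of_nat (CARD('a) ^ (CARD('d) * CARD('n)) * card (rank_one_points b a))"
proof -
  let ?Q = "of_nat (CARD('a) ^ (CARD('d) * CARD('n))) :: complex"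
  have "(\<Sum>x\<in>UNIV. of_nat (card (vanishing_points b x)) * \<psi> (- tuple_dot a x)) =
      (\<Sum>x\<in>UNIV. \<Sum>u\<in>UNIV. if u \<in> vanishing_points b x then \<psi> (- tuple_dot a x) else 0)"
    by (simp flip: sum.inter_restrict)
  also have "\<dots> = (\<Sum>u\<in>UNIV. \<Sum>x | u \<in> vanishing_points b x. \<psi> (- tuple_dot a x))"
    by (subst sum.swap) (simp flip: sum.inter_filter)
  also have "\<dots> = (\<Sum>u\<in>UNIV. if u \<in> rank_one_points b a then ?Q else 0)"
  proof (intro sum.cong refl)
    fix u :: "'a ^ 'n"
    show "(\<Sum>x | u \<in> vanishing_points b x. \<psi> (- tuple_dot a x)) =
        (if u \<in> rank_one_points b a then ?Q else 0)"
      \<comment> \<open>Vanishing at \<open>u\<close> is a linear condition on the coefficients,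
        with the powers of the coordinates of \<open>u\<close> as the constants
        \<open>V\<close>.\<close>
      using sum_annihilator[where a = a and V = "\<lambda>i. \<chi> j. (u $ j) ^ b i j"]
      by (simp add: vanishing_points_def rank_one_points_def poly_tuple_def poly_fun_def)
  qed
  also have "\<dots> = ?Q * of_nat (card (rank_one_points b a))"
    by (simp add: mult.commute flip: sum.inter_restrict)
  finally show ?thesis by simp
qed

text \<open>After replacing \<open>y\<close> by \<open>y - x\<close> the character value splits into
  a factor in \<open>x\<close> and one in \<open>y\<close>, so convolution with any \<open>c\<close>
  scales the character by the Fourier coefficient of \<open>c\<close> at \<open>a\<close>.\<close>

lemma convolution_character:
  fixes b :: "'d::finite \<Rightarrow> 'n::finite \<Rightarrow> nat" and a :: "'d \<Rightarrow> ('a ^ 'n) \<times> 'a"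
  shows "(\<Sum>x\<in>UNIV. Poly_Mapping.single (poly_tuple b x) (c x)) *
      (\<Sum>y\<in>UNIV. Poly_Mapping.single (poly_tuple b y) (\<psi> (tuple_dot a y))) =
    (\<Sum>y\<in>UNIV. Poly_Mapping.single (poly_tuple b y)
      ((\<Sum>x\<in>UNIV. c x * \<psi> (- tuple_dot a x)) * \<psi> (tuple_dot a y)))" (is "?L = ?R")
proof -
  have shift: "(\<Sum>y\<in>UNIV. Poly_Mapping.single (poly_tuple b (x + y)) (c x * \<psi> (tuple_dot a y))) =
      (\<Sum>y\<in>UNIV. Poly_Mapping.single (poly_tuple b y) (c x * \<psi> (- tuple_dot a x) * \<psi> (tuple_dot a y)))"
    for x
  proof (rule sum.reindex_bij_witness[of _ "\<lambda>y. y - x" "\<lambda>y. x + y"])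
    fix y
    have "\<psi> (tuple_dot a y) = \<psi> (- tuple_dot a x) * \<psi> (tuple_dot a (x + y))"
      by (simp add: tuple_dot_add_right flip: add)
    then show "Poly_Mapping.single (poly_tuple b (x + y))
        (c x * \<psi> (- tuple_dot a x) * \<psi> (tuple_dot a (x + y))) =
      Poly_Mapping.single (poly_tuple b (x + y)) (c x * \<psi> (tuple_dot a y))" by (simp only: mult.assoc)
  qed auto
  have "?L = (\<Sum>x\<in>UNIV. \<Sum>y\<in>UNIV.
      Poly_Mapping.single (poly_tuple b (x + y)) (c x * \<psi> (tuple_dot a y)))"
    by (simp add: sum_product mult_single poly_tuple_add)
  also have "\<dots> = (\<Sum>y\<in>UNIV. \<Sum>x\<in>UNIV.
      Poly_Mapping.single (poly_tuple b y) (c x * \<psi> (- tuple_dot a x) * \<psi> (tuple_dot a y)))"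
    unfolding shift by (rule sum.swap)
  also have "\<dots> = ?R"
    by (simp add: sum_distrib_right single_sum)
  finally show ?thesis .
qed

end

section \<open>Counting the characters\<close>

lemma rank_one_points_0: "rank_one_points b (\<lambda>_. 0) = UNIV"
  by (simp add: rank_one_points_def)

text \<open>The last coordinates force \<open>c i = snd (a i)\<close>, and for a given
  \<open>y\<close> these all vanish only if \<open>a\<close> does.\<close>

lemma common_point_eq:
  "common_point b = {a. a \<noteq> (\<lambda>_. 0) \<and> rank_one_points b a \<noteq> {}}"
proof (intro set_eqI iffI)
  fix a assume "a \<in> common_point b"
  then obtain y c where "c \<noteq> (\<lambda>_. 0)" and a: "\<And>i. a i = ((\<chi> j. c i * (y $ j) ^ b i j), c i)"
    by (auto simp: common_point_def)
  moreover have "y \<in> rank_one_points b a" by (simp add: a rank_one_points_def)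
  ultimately show "a \<in> {a. a \<noteq> (\<lambda>_. 0) \<and> rank_one_points b a \<noteq> {}}"
    by (auto simp: fun_eq_iff prod_eq_iff)
next
  fix a assume a: "a \<in> {a. a \<noteq> (\<lambda>_. 0) \<and> rank_one_points b a \<noteq> {}}"
  then obtain y where y: "y \<in> rank_one_points b a" by auto
  then have eq: "a i = ((\<chi> j. snd (a i) * (y $ j) ^ b i j), snd (a i))" for i
    by (simp add: rank_one_points_def prod_eq_iff vec_eq_iff)
  moreover have "(\<lambda>i. snd (a i)) \<noteq> (\<lambda>_. 0)"
    using a y by (auto simp: rank_one_points_def fun_eq_iff prod_eq_iff vec_eq_iff)
  ultimately show "a \<in> common_point b"
    unfolding common_point_def by (intro CollectI exI[of _ y] exI[of _ "\<lambda>i. snd (a i)"]) blast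
qed

text \<open>A nonzero \<open>snd (a i)\<close> can be cancelled, and the power maps of row
  \<open>i\<close> are injective, so this row alone determines the point.\<close>

lemma rank_one_points_unique:
  fixes a :: "'d::finite \<Rightarrow> ('a::finite_field ^ 'n::finite) \<times> 'a"
  assumes inj: "\<And>i j. inj (\<lambda>x :: 'a. x ^ b i j)"
    and "a \<noteq> (\<lambda>_. 0)" and y: "y \<in> rank_one_points b a" and u: "u \<in> rank_one_points b a"
  shows "y = u"
proof -
  \<comment> \<open>If every last coordinate were 0, membership of \<open>y\<close> would make
    \<open>a\<close> zero.\<close>
  obtain i where i: "snd (a i) \<noteq> 0"
    using assms(2) y by (auto simp: rank_one_points_def fun_eq_iff prod_eq_iff vec_eq_iff)
  have "(y $ j) ^ b i j = (u $ j) ^ b i j" for j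
    using y u i unfolding rank_one_points_def
    by (metis (mono_tags, lifting) mem_Collect_eq mult_left_cancel)
  then show ?thesis using inj by (auto simp: vec_eq_iff dest: injD)
qed

text \<open>Pairs of a point \<open>y\<close> and a nonzero \<open>c\<close> parametrise the set;
  \<open>c\<close> is read off the last coordinates, and \<open>y\<close> is recovered by uniqueness
  of the point.\<close>

lemma card_common_point:
  fixes b :: "'d::finite \<Rightarrow> 'n::finite \<Rightarrow> nat"
  assumes inj: "\<And>i j. inj (\<lambda>x :: 'a::finite_field. x ^ b i j)"
  shows "card (common_point b :: ('d \<Rightarrow> ('a ^ 'n) \<times> 'a) set) =
    CARD('a) ^ CARD('n) * (CARD('a) ^ CARD('d) - 1)"
proof -
  define F :: "('a ^ 'n) \<times> ('d \<Rightarrow> 'a) \<Rightarrow> 'd \<Rightarrow> ('a ^ 'n) \<times> 'a" where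
    "F = (\<lambda>(y, c) i. ((\<chi> j. c i * (y $ j) ^ b i j), c i))"
  let ?S = "UNIV \<times> (UNIV - {\<lambda>_. 0}) :: (('a ^ 'n) \<times> ('d \<Rightarrow> 'a)) set"
  have "common_point b = F ` ?S"
  proof (intro set_eqI iffI)
    fix a :: "'d \<Rightarrow> ('a ^ 'n) \<times> 'a"
    assume "a \<in> common_point b"
    then obtain y c where "c \<noteq> (\<lambda>_. 0)" and "\<And>i. a i = ((\<chi> j. c i * (y $ j) ^ b i j), c i)"
      unfolding common_point_def by blast
    then show "a \<in> F ` ?S"
      by (intro image_eqI[of _ _ "(y, c)"]) (simp_all add: F_def fun_eq_iff)
  next
    fix a :: "'d \<Rightarrow> ('a ^ 'n) \<times> 'a"
    assume "a \<in> F ` ?S"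
    then obtain y c where "c \<noteq> (\<lambda>_. 0)" and "a = F (y, c)" by blast
    then show "a \<in> common_point b"
      unfolding common_point_def F_def by auto
  qed
  moreover have "inj_on F ?S"
  proof (rule inj_onI)
    fix s s'
    assume "s \<in> ?S" and "F s = F s'"
    moreover obtain y c y' c' where s: "s = (y, c)" "s' = (y', c')" by (cases s, cases s')
    ultimately have c: "c \<noteq> (\<lambda>_. 0)" and eq: "F (y, c) = F (y', c')" by simp_all
    then have "c = c'" by (simp add: F_def fun_eq_iff)
    moreover have "y \<in> rank_one_points b (F (y, c))" "y' \<in> rank_one_points b (F (y', c'))"
      by (simp_all add: F_def rank_one_points_def)
    moreover have "F (y, c) \<noteq> (\<lambda>_. 0)" using c by (auto simp: F_def fun_eq_iff prod_eq_iff)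
    ultimately show "s = s'"
      unfolding s using rank_one_points_unique[where b = b, OF inj, of "F (y, c)" y y'] eq by simp
  qed
  moreover have "card ?S = CARD('a) ^ CARD('n) * (CARD('a) ^ CARD('d) - 1)"
    by (simp add: card_cartesian_product card_Diff_singleton card_fun)
  ultimately show ?thesis by (simp add: card_image)
qed

text \<open>Congruent exponents induce one power map per coordinate, common to all rows. Being
  injective on a finite field it is bijective, so the coordinatewise powers of \<open>y\<close>
  range over all vectors.\<close>

lemma common_point_eq_common_dir:
  fixes b :: "'d::finite \<Rightarrow> 'n::finite \<Rightarrow> nat"
  assumes pos: "\<And>i j. b i j > 0"
    and inj: "\<And>i j. inj (\<lambda>x :: 'a::finite_field. x ^ b i j)"
    and cong: "\<And>i i' j. [b i j = b i' j] (mod (CARD('a) - 1))"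
  shows "common_point b = (common_dir :: ('d \<Rightarrow> ('a ^ 'n) \<times> 'a) set)"
proof -
  fix i0 :: 'd
  \<comment> \<open>The congruence governs nonzero \<open>x\<close>; at 0 both powers are 0 by
    positivity.\<close>
  have pow: "x ^ b i j = x ^ b i0 j" for x :: 'a and i j
    using finite_field_power_eq_if_cong[OF _ cong, of x i j i0] pos[of i j] pos[of i0 j]
    by (cases "x = 0") (auto simp: power_0_left)
  have surj: "surj (\<lambda>x :: 'a. x ^ b i0 j)" for j
    using inj[of i0 j] by (simp add: finite_UNIV_inj_surj)
  show ?thesis
  proof (intro set_eqI iffI)
    fix a :: "'d \<Rightarrow> ('a ^ 'n) \<times> 'a"
    assume "a \<in> common_point b"
    then obtain y c where c: "c \<noteq> (\<lambda>_. 0)" and a: "\<And>i. a i = ((\<chi> j. c i * (y $ j) ^ b i j), c i)"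
      by (auto simp: common_point_def)
    have "a i = ((\<chi> j. c i * (y $ j) ^ b i0 j), c i)" for i
      by (simp add: a pow[of _ i])
    with c show "a \<in> common_dir"
      unfolding common_dir_def
      by (intro CollectI exI[of _ "\<chi> j. (y $ j) ^ b i0 j"] exI[of _ c]) simp
  next
    fix a :: "'d \<Rightarrow> ('a ^ 'n) \<times> 'a"
    assume "a \<in> common_dir"
    then obtain y c where c: "c \<noteq> (\<lambda>_. 0)" and a: "\<And>i. a i = ((\<chi> j. c i * y $ j), c i)"
      by (auto simp: common_dir_def)
    have "\<exists>x. \<forall>j. y $ j = x j ^ b i0 j" using surj by (intro choice) (metis surjD)
    then obtain x where x: "\<And>j. y $ j = x j ^ b i0 j" by blast
    have "a i = ((\<chi> j. c i * x j ^ b i j), c i)" for i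
      by (simp add: a x pow[of _ i])
    with c show "a \<in> common_point b"
      unfolding common_point_def
      by (intro CollectI exI[of _ "\<chi> j. x j"] exI[of _ c]) simp
  qed
qed

text \<open>The second class is \<open>common_point b\<close>; the final conjunct identifies it with
  \<open>common_dir\<close> when the exponents of each coordinate agree modulo q - 1. Cardinalities
  are compared over the integers to avoid truncated subtraction.\<close>

theorem theorem3p9:
  fixes b :: "'d::finite \<Rightarrow> 'n::finite \<Rightarrow> nat"
    and p m q n d :: nat
    and z :: "('d \<Rightarrow> 'a::finite_field ^ 'n \<Rightarrow> 'a) \<Rightarrow>\<^sub>0 complex"
    and A0 A1 :: "('d \<Rightarrow> ('a ^ 'n) \<times> 'a) set"
    and X0 X1 X2 :: "(('d \<Rightarrow> 'a ^ 'n \<Rightarrow> 'a) \<Rightarrow>\<^sub>0 complex) set"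
  assumes "prime p" and "q = p ^ m" and "CARD('a) = q"
    and "CARD('n) = n" and "CARD('d) = d"
    and "\<And>i j. b i j > 0" and "\<And>i j. coprime (b i j) (q - 1)"
    and "z = zero_count_elem b"
    and "A0 = {\<lambda>_. 0}"
    and "A1 = common_point b"
    and "X0 = chi_elem p m b ` A0"
    and "X1 = chi_elem p m b ` A1"
    and "X2 = range (chi_elem p m b) - X0 - X1"
  shows "card X0 = 1 \<and>
      (\<forall>w\<in>X0. eigenvector_in (group_algebra (poly_group b)) (phi z) (of_nat (q ^ ((d + 1) * n))) w) \<and>
      int (card X1) = int q ^ (n + d) - int q ^ n \<and>
      (\<forall>w\<in>X1. eigenvector_in (group_algebra (poly_group b)) (phi z) (of_nat (q ^ (d * n))) w) \<and>
      int (card X2) = int q ^ (d * (n + 1)) - int q ^ (n + d) + int q ^ n - 1 \<and>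
      (\<forall>w\<in>X2. eigenvector_in (group_algebra (poly_group b)) (phi z) 0 w) \<and>
      ((\<forall>i i' j. [b i j = b i' j] (mod (q - 1))) \<longrightarrow> A1 = common_dir)"
proof -
  note pos = assms(6)
  have CHAR: "CHAR('a) = p"
    using assms(1-3) by (intro CHAR_eq_of_CARD_eq_prime_power) auto
  have card_a: "CARD('a) = p ^ m" using assms(2,3) by simp
  have p1: "p > 1" using assms(1) by (rule prime_gt_1_nat)
  define \<psi> where "\<psi> = (\<lambda>x :: 'a. prime_exp p (field_trace p m x))"
  \<comment> \<open>Trace values lie in the prime field, where \<open>prime_exp\<close> has its
    intended meaning.\<close>
  have tr: "\<exists>k<p. field_trace p m x = of_nat k" for x :: 'a
    using field_trace_prime_subfield[OF CHAR card_a, of x] by metis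
  interpret nontrivial_add_char \<psi>
  proof
    have "field_trace p m (0 :: 'a) = of_nat 0"
      using p1 by (simp add: field_trace_def power_0_left)
    then show "\<psi> 0 = 1"
      unfolding \<psi>_def by (simp only: prime_exp_of_nat[OF assms(1) CHAR]) simp
    show "\<psi> (x + y) = \<psi> x * \<psi> y" for x y
    proof -
      obtain k l where kl: "field_trace p m x = of_nat k" "field_trace p m y = of_nat l"
        using tr by meson
      then have "field_trace p m (x + y) = of_nat (k + l)"
        by (simp add: field_trace_add[OF assms(1) CHAR])
      with kl show ?thesis
        unfolding \<psi>_def
        by (simp only: prime_exp_of_nat[OF assms(1) CHAR])
          (simp add: cis_mult add_divide_distrib distrib_left)
    qed
    obtain x :: 'a where x: "field_trace p m x \<noteq> 0"
      using field_trace_nonzero[OF assms(1) card_a] by blast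
    obtain k where k: "k < p" "field_trace p m x = of_nat k" using tr by blast
    have "k > 0" using x k by (cases k) auto
    \<comment> \<open>Since 0 < k < p, the value 1 would make k/p an integer.\<close>
    have "cis (2 * pi * real k / real p) \<noteq> 1"
    proof
      assume "cis (2 * pi * real k / real p) = 1"
      then obtain r :: int where "2 * pi * real k / real p = of_int r * (2 * pi)"
        by (auto simp: complex_eq_iff cos_one_2pi_int mult.assoc)
      then have "real k = of_int r * real p" using p1 by (simp add: field_simps)
      then have "int k = r * int p" by (metis of_int_eq_iff of_int_mult of_int_of_nat_eq)
      then have "p dvd k" by (metis dvd_triv_right int_dvd_int_iff)
      then show False using \<open>k > 0\<close> k(1) by (simp add: nat_dvd_not_less)
    qed
    then show "\<exists>x. \<psi> x \<noteq> 1"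
      using k by (intro exI[of _ x]) (simp add: \<psi>_def prime_exp_of_nat[OF assms(1) CHAR])
  qed
  have inj_pow: "inj (\<lambda>x :: 'a. x ^ b i j)" for i j
    using assms(3,6,7) by (intro inj_power_finite_field) auto
  have inj_pt: "inj (poly_tuple b :: ('d \<Rightarrow> ('a ^ 'n) \<times> 'a) \<Rightarrow> _)"
    by (rule inj_poly_tuple) (rule pos)
  have chi: "chi_elem p m b a = (\<Sum>x\<in>UNIV. Poly_Mapping.single (poly_tuple b x) (\<psi> (tuple_dot a x)))"
    for a :: "'d \<Rightarrow> ('a ^ 'n) \<times> 'a"
    by (simp add: chi_elem_def sum_poly_group[OF pos] chi_def coeffs_of_poly_tuple[OF pos]
        \<psi>_def tuple_dot_def)
  have z: "z = (\<Sum>x\<in>UNIV. Poly_Mapping.single (poly_tuple b x) (of_nat (card (vanishing_points b x))))"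
    by (simp add: assms(8) zero_count_elem_def sum_poly_group[OF pos] vanishing_points_def)
  have lookup_chi: "Poly_Mapping.lookup (chi_elem p m b a) (poly_tuple b x) = \<psi> (tuple_dot a x)"
    for a x :: "'d \<Rightarrow> ('a ^ 'n) \<times> 'a"
    unfolding chi by (rule lookup_sum_single_inj[OF _ inj_pt]) simp
  \<comment> \<open>Characters with different labels differ at a point where the character of
    \<open>a - a'\<close> is not 1. This lets characters be counted by their labels.\<close>
  have inj_chi: "inj (chi_elem p m b :: ('d \<Rightarrow> ('a ^ 'n) \<times> 'a) \<Rightarrow> _)"
  proof (rule injI, rule ccontr)
    fix a a' :: "'d \<Rightarrow> ('a ^ 'n) \<times> 'a"
    assume eq: "chi_elem p m b a = chi_elem p m b a'" and "a \<noteq> a'"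
    then obtain x where x: "\<psi> (tuple_dot (a - a') x) \<noteq> 1"
      using ex_tuple_dot[of "a - a'"] by auto
    have "\<psi> (tuple_dot a x) = \<psi> (tuple_dot (a - a') x) * \<psi> (tuple_dot a' x)"
      by (simp add: tuple_dot_diff_left flip: add)
    moreover have "\<psi> (tuple_dot a x) = \<psi> (tuple_dot a' x)" using eq lookup_chi by metis
    moreover have "\<psi> (tuple_dot a' x) \<noteq> 0"
      using zero add[of "tuple_dot a' x" "- tuple_dot a' x"] by auto
    ultimately show False using x by simp
  qed
  \<comment> \<open>One formula covers the three classes: the number of points is q^n for the zero
    tuple, 1 on \<open>A1\<close> and 0 for the rest.\<close>
  have eigen: "eigenvector_in (group_algebra (poly_group b)) (phi z)
      (of_nat (q ^ (d * n) * card (rank_one_points b a))) (chi_elem p m b a)"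
    for a :: "'d \<Rightarrow> ('a ^ 'n) \<times> 'a"
  proof -
    let ?l = "of_nat (q ^ (d * n) * card (rank_one_points b a)) :: complex"
    have keys: "Poly_Mapping.keys (chi_elem p m b a) \<subseteq> poly_group b"
      unfolding chi using keys_sum[of "\<lambda>x. Poly_Mapping.single (poly_tuple b x) (\<psi> (tuple_dot a x))" UNIV]
      by (fastforce simp: poly_group_def split: if_splits)
    \<comment> \<open>A character is 1 at the neutral element, so its element of the algebra is not
      zero.\<close>
    have "Poly_Mapping.lookup (chi_elem p m b a) (poly_tuple b 0) = 1"
      by (simp add: lookup_chi tuple_dot_def dot_def zero)
    then have ne: "chi_elem p m b a \<noteq> 0" by auto
    have "z * chi_elem p m b a =
        (\<Sum>x\<in>UNIV. Poly_Mapping.single (poly_tuple b x) (?l * \<psi> (tuple_dot a x)))"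
      unfolding z chi convolution_character zero_count_fourier using assms(3-5) by simp
    also have "\<dots> = Poly_Mapping.map ((*) ?l) (chi_elem p m b a)"
      by (rule poly_mapping_eqI)
        (auto simp: lookup_map_mult chi lookup_sum lookup_single sum_distrib_left when_def
          intro!: sum.cong)
    finally show ?thesis using keys ne by (simp add: eigenvector_in_def group_algebra_def phi_def)
  qed

  \<comment> \<open>Multiplicities of the three eigenvalues\<close>
  have card_X1: "card X1 = q ^ n * (q ^ d - 1)"
    using card_common_point[where b = b, OF inj_pow] assms(3-5)
    by (simp add: assms(10,12) card_image[OF inj_on_subset[OF inj_chi]])
  have q0: "q > 0" using assms(3) by (metis zero_less_card_finite)
  have X1: "int (card X1) = int q ^ (n + d) - int q ^ n"
    using q0 by (simp add: card_X1 of_nat_diff algebra_simps power_add)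
  have A01: "A0 \<inter> A1 = {}" by (simp add: assms(9,10) common_point_eq)
  have X01: "X0 \<inter> X1 = {}"
    using A01 by (simp add: assms(11,12) flip: image_Int[OF inj_chi])
  \<comment> \<open>The number of all characters, from which \<open>X2\<close> is counted by
    subtraction.\<close>
  have "card (range (chi_elem p m b :: ('d \<Rightarrow> ('a ^ 'n) \<times> 'a) \<Rightarrow> _)) = q ^ (d * (n + 1))"
  proof -
    have "CARD('d \<Rightarrow> ('a ^ 'n) \<times> 'a) = (CARD('a) ^ CARD('n) * CARD('a)) ^ CARD('d)"
      by (simp add: card_fun)
    also have "\<dots> = q ^ (d * (n + 1))"
      by (simp only: assms(3-5) mult.commute[of d] power_mult power_Suc2 flip: Suc_eq_plus1)
    finally show ?thesis by (simp add: card_image[OF inj_chi])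
  qed
  moreover have "card X2 = card (range (chi_elem p m b :: ('d \<Rightarrow> ('a ^ 'n) \<times> 'a) \<Rightarrow> _)) - card (X0 \<union> X1)"
    unfolding assms(13)
    by (subst card_Diff_subset[symmetric]) (auto simp: assms(11,12) Diff_eq Int_assoc)
  moreover have "card (X0 \<union> X1) \<le> card (range (chi_elem p m b :: ('d \<Rightarrow> ('a ^ 'n) \<times> 'a) \<Rightarrow> _))"
    by (rule card_mono) (auto simp: assms(11,12))
  moreover have X0: "card X0 = 1" by (simp add: assms(9,11))
  moreover have "card (X0 \<union> X1) = card X0 + card X1"
    using X01 by (intro card_Un_disjoint) (auto simp: assms(9,11,12))
  ultimately have X2: "int (card X2) = int q ^ (d * (n + 1)) - int q ^ (n + d) + int q ^ n - 1"
    using X1 by (simp add: of_nat_diff)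

  \<comment> \<open>Eigenvalues on the three classes\<close>
  have "eigenvector_in (group_algebra (poly_group b)) (phi z) (of_nat (q ^ ((d + 1) * n))) w"
    if "w \<in> X0" for w
  proof -
    have "q ^ (d * n) * card (rank_one_points b (\<lambda>_::'d. 0 :: ('a ^ 'n) \<times> 'a)) = q ^ ((d + 1) * n)"
      using assms(3,4) by (simp add: rank_one_points_0 power_add mult.commute)
    then show ?thesis using that eigen[of "\<lambda>_. 0"] by (simp only: assms(9,11)) simp
  qed
  moreover have "eigenvector_in (group_algebra (poly_group b)) (phi z) (of_nat (q ^ (d * n))) w"
    if w: "w \<in> X1" for w
  proof -
    obtain a where a: "w = chi_elem p m b a" "a \<noteq> (\<lambda>_. 0)" "rank_one_points b a \<noteq> {}"
      using w by (auto simp: assms(10,12) common_point_eq)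
    then have "is_singleton (rank_one_points b a)"
      using rank_one_points_unique[where b = b, OF inj_pow] by (intro is_singletonI') blast+
    then have "card (rank_one_points b a) = 1" by (simp add: is_singleton_altdef)
    then show ?thesis using eigen[of a] a(1) by simp
  qed
  moreover have "eigenvector_in (group_algebra (poly_group b)) (phi z) 0 w" if w: "w \<in> X2" for w
  proof -
    obtain a where a: "w = chi_elem p m b a" "a \<notin> A0" "a \<notin> A1"
      using w by (auto simp: assms(11-13))
    then have "rank_one_points b a = {}" by (simp add: assms(9,10) common_point_eq)
    then show ?thesis using eigen[of a] a(1) by simp
  qed
  moreover have "A1 = common_dir" if "\<forall>i i' j. [b i j = b i' j] (mod (q - 1))"
    unfolding assms(10) using that assms(3) pos inj_pow by (intro common_point_eq_common_dir) auto
  ultimately show ?thesis using X0 X1 X2 by blast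
qed

end
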